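(* Let $G$ be a bi-directed graph and let $G^{\min}$ be a minimally oriented graph of $G$. Then $G$ is Markov equivalent to a directed acyclic graph if and only if $G^{\min}$ contains no bi-directed edges.
   Context: A simple mixed graph $G=(V,E)$ has a finite vertex set $V$ and at most one edge between any two distinct vertices (no loops), each edge being undirected ($v-w$), directed ($v\to w$ or $v\leftarrow w$), or bi-directed ($v\leftrightarrow w$). An edge $v\leftarrow w$ or $v\leftrightarrow w$ has an arrowhead at $v$; an edge $v\to w$ or $v-w$ has a tail at $v$. A bi-directed (undirected, directed) graph has only bi-directed (undirected, directed) edges; a directed acyclic graph (DAG) is a directed graph without directed cycles. Vertices are adjacent if joined by an edge of any type. A path is a sequence of distinct vertices with consecutive ones adjacent. $v$ is an ancestor of $w$ if $v=w$ or there is a directed path $v\to\cdots\to w$; $\mathrm{An}(C)$ is the set of ancestors of elements of $C$. Ancestral graph: a simple mixed graph such that (i) there are no directed cycles; (ii) if $v-w\in G$ then there is no $u$ with $u\to v\in G$ or $u\leftrightarrow v\in G$; (iii) if $v\leftrightarrow w\in G$ then $v$ is not an ancestor of $w$. (Bi-directed graphs and DAGs are ancestral.) m-separation: a non-endpoint vertex on a path is a collider if both path edges at it have an arrowhead at it, otherwise a non-collider. A path between $v$ and $w$ is $m$-connecting given $C\subseteq V\setminus\{v,w\}$ if every non-collider on it is not in $C$ and every collider on it is in $\mathrm{An}(C)$. $v,w$ are $m$-separated given $C$ if no path $m$-connects them given $C$; disjoint non-empty sets $A,B$ are $m$-separated given $C\subseteq V\setminus(A\cup B)$ if every $v\in A$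 and $w\in B$ are. An ancestral graph is maximal if for every pair of distinct non-adjacent vertices $v,w$ there is some $C\subseteq V\setminus\{v,w\}$ such that $v,w$ are $m$-separated given $C$. Two ancestral graphs on the same vertex set are Markov equivalent if they have the same $m$-separations (the same triples $(A,B,C)$ with $A,B$ $m$-separated given $C$). Minimally oriented graph of a bi-directed graph $G$: a graph $G^{\min}$ such that (i) $G^{\min}$ is a maximal ancestral graph; (ii) $G$ and $G^{\min}$ are Markov equivalent; (iii) $G^{\min}$ has the minimum number of arrowheads among all maximal ancestral graphs Markov equivalent to $G$, where the number of arrowheads of a graph with $d$ directed and $b$ bi-directed edges is $d+2b$. *)

theory Defs
  imports Main
begin

text \<open>Undirected and bi-directed edges are unordered pairs; \<open>(v, w)\<close> is the directed edge from
  \<open>v\<close> to \<open>w\<close>.\<close>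

record 'v mixed_graph =
  verts :: "'v set"
  undirected_edges :: "'v set set"
  directed_edges :: "('v \<times> 'v) set"
  bidirected_edges :: "'v set set"

definition simple_mixed_graph :: "'v mixed_graph \<Rightarrow> bool" where
  "simple_mixed_graph G \<longleftrightarrow>
     finite (verts G) \<and>
     (\<forall>e \<in> undirected_edges G \<union> bidirected_edges G.
        \<exists>v\<in>verts G. \<exists>w\<in>verts G. v \<noteq> w \<and> e = {v, w}) \<and>
     (\<forall>(v, w) \<in> directed_edges G. v \<in> verts G \<and> w \<in> verts G \<and> v \<noteq> w) \<and>
     undirected_edges G \<inter> bidirected_edges G = {} \<and>
     (\<forall>(v, w) \<in> directed_edges G.
        (w, v) \<notin> directed_edges G \<and> {v, w} \<notin> undirected_edges G \<union> bidirected_edges G)"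

definition bidirected_graph :: "'v mixed_graph \<Rightarrow> bool" where
  "bidirected_graph G \<longleftrightarrow>
     simple_mixed_graph G \<and> undirected_edges G = {} \<and> directed_edges G = {}"

definition directed_graph :: "'v mixed_graph \<Rightarrow> bool" where
  "directed_graph G \<longleftrightarrow>
     simple_mixed_graph G \<and> undirected_edges G = {} \<and> bidirected_edges G = {}"

definition dag :: "'v mixed_graph \<Rightarrow> bool" where
  "dag G \<longleftrightarrow> directed_graph G \<and> acyclic (directed_edges G)"

definition adjacent :: "'v mixed_graph \<Rightarrow> 'v \<Rightarrow> 'v \<Rightarrow> bool" where
  "adjacent G v w \<longleftrightarrow>
     {v, w} \<in> undirected_edges G \<or> (v, w) \<in> directed_edges G \<or> (w, v) \<in> directed_edges G \<or>
     {v, w} \<in> bidirected_edges G"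

text \<open>The edge between \<open>u\<close> and \<open>v\<close> has an arrowhead at \<open>v\<close>, the second argument.\<close>

definition arrowhead_at :: "'v mixed_graph \<Rightarrow> 'v \<Rightarrow> 'v \<Rightarrow> bool" where
  "arrowhead_at G u v \<longleftrightarrow> (u, v) \<in> directed_edges G \<or> {u, v} \<in> bidirected_edges G"

definition ancestor :: "'v mixed_graph \<Rightarrow> 'v \<Rightarrow> 'v \<Rightarrow> bool" where
  "ancestor G v w \<longleftrightarrow> (v, w) \<in> (directed_edges G)\<^sup>*"

definition An :: "'v mixed_graph \<Rightarrow> 'v set \<Rightarrow> 'v set" where
  "An G C = {v. \<exists>w\<in>C. ancestor G v w}"

definition ancestral :: "'v mixed_graph \<Rightarrow> bool" where
  "ancestral G \<longleftrightarrow>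
     simple_mixed_graph G \<and>
     acyclic (directed_edges G) \<and>
     (\<forall>v w. {v, w} \<in> undirected_edges G \<longrightarrow> (\<nexists>u. arrowhead_at G u v)) \<and>
     (\<forall>v w. {v, w} \<in> bidirected_edges G \<longrightarrow> \<not> ancestor G v w)"

definition path_between :: "'v mixed_graph \<Rightarrow> 'v \<Rightarrow> 'v list \<Rightarrow> 'v \<Rightarrow> bool" where
  "path_between G v p w \<longleftrightarrow>
     p \<noteq> [] \<and> set p \<subseteq> verts G \<and> distinct p \<and> successively (adjacent G) p \<and>
     hd p = v \<and> last p = w"

definition collider :: "'v mixed_graph \<Rightarrow> 'v list \<Rightarrow> nat \<Rightarrow> bool" where
  "collider G p i \<longleftrightarrow> arrowhead_at G (p ! (i - 1)) (p ! i) \<and> arrowhead_at G (p ! (i + 1)) (p ! i)"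

definition m_connecting :: "'v mixed_graph \<Rightarrow> 'v list \<Rightarrow> 'v set \<Rightarrow> bool" where
  "m_connecting G p C \<longleftrightarrow>
     (\<forall>i. 0 < i \<and> i + 1 < length p \<longrightarrow>
        (if collider G p i then p ! i \<in> An G C else p ! i \<notin> C))"

text \<open>Only meaningful for distinct \<open>v, w \<in> verts G\<close> and \<open>C \<subseteq> verts G - {v, w}\<close>.\<close>

definition m_separated_verts :: "'v mixed_graph \<Rightarrow> 'v \<Rightarrow> 'v \<Rightarrow> 'v set \<Rightarrow> bool" where
  "m_separated_verts G v w C \<longleftrightarrow> (\<nexists>p. path_between G v p w \<and> m_connecting G p C)"

definition m_separated :: "'v mixed_graph \<Rightarrow> 'v set \<Rightarrow> 'v set \<Rightarrow> 'v set \<Rightarrow> bool" where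
  "m_separated G A B C \<longleftrightarrow>
     A \<noteq> {} \<and> B \<noteq> {} \<and> A \<subseteq> verts G \<and> B \<subseteq> verts G \<and> A \<inter> B = {} \<and>
     C \<subseteq> verts G - (A \<union> B) \<and>
     (\<forall>v\<in>A. \<forall>w\<in>B. m_separated_verts G v w C)"

definition maximal_ancestral :: "'v mixed_graph \<Rightarrow> bool" where
  "maximal_ancestral G \<longleftrightarrow>
     ancestral G \<and>
     (\<forall>v\<in>verts G. \<forall>w\<in>verts G. v \<noteq> w \<and> \<not> adjacent G v w \<longrightarrow>
        (\<exists>C \<subseteq> verts G - {v, w}. m_separated_verts G v w C))"

definition markov_equivalent :: "'v mixed_graph \<Rightarrow> 'v mixed_graph \<Rightarrow> bool" where
  "markov_equivalent G H \<longleftrightarrow>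
     ancestral G \<and> ancestral H \<and> verts G = verts H \<and>
     (\<forall>A B C. m_separated G A B C \<longleftrightarrow> m_separated H A B C)"

definition arrowheads :: "'v mixed_graph \<Rightarrow> nat" where
  "arrowheads G = card (directed_edges G) + 2 * card (bidirected_edges G)"

definition minimally_oriented :: "'v mixed_graph \<Rightarrow> 'v mixed_graph \<Rightarrow> bool" where
  "minimally_oriented G Gmin \<longleftrightarrow>
     maximal_ancestral Gmin \<and> markov_equivalent G Gmin \<and>
     (\<forall>H. maximal_ancestral H \<and> markov_equivalent G H \<longrightarrow> arrowheads Gmin \<le> arrowheads H)"

lemma bidirected_graph_ancestral:
  assumes "bidirected_graph G"
  shows "ancestral G"
proof -
  have "v \<noteq> w" if "{v, w} \<in> bidirected_edges G" for v w
    using assms that unfolding bidirected_graph_def simple_mixed_graph_def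
    by (fastforce simp: doubleton_eq_iff)
  then show ?thesis
    using assms by (auto simp: ancestral_def bidirected_graph_def ancestor_def acyclic_def)
qed

lemma dag_ancestral: "dag G \<Longrightarrow> ancestral G"
  by (auto simp: dag_def directed_graph_def ancestral_def)

end

theory Submission
  imports Defs
begin

text \<open>Let \<open>N v\<close> be the closed neighbourhood of \<open>v\<close>. In a bi-directed graph every unshielded triple is a
  collider, so an ancestral graph \<open>H\<close> with the same adjacencies is Markov equivalent to it iff a tail
  at \<open>u\<close> on an edge between \<open>u\<close> and \<open>x\<close> forces \<open>N u \<subseteq> N x\<close>. Hence a Markov equivalent graph without
  bi-directed edges makes \<open>N v\<close> and \<open>N w\<close> comparable for all adjacent \<open>v, w\<close>. Conversely, under
  comparability, orienting each edge towards the larger neighbourhood and breaking ties by a linear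
  order gives an equivalent DAG. Leaving edges undirected where \<open>N\<close> is locally minimal instead gives a
  maximal ancestral graph \<open>H\<close>, and every edge directed in \<open>H\<close> carries an arrowhead in any equivalent
  maximal ancestral graph; counting arrowheads, a minimally oriented graph has no bi-directed
  edges.\<close>

section \<open>Closed neighbourhoods, tails and walks\<close>

definition closed_nbhd :: "'v mixed_graph \<Rightarrow> 'v \<Rightarrow> 'v set" where
  "closed_nbhd G v = {w. w = v \<or> adjacent G v w}"

text \<open>A tail is expressed as an absent arrowhead, so directed and undirected edges are treated
  together; an undirected edge falls under the condition in both directions and forces equal
  neighbourhoods.\<close>

definition tails_respect_nbhds :: "'v mixed_graph \<Rightarrow> bool" where
  "tails_respect_nbhds H \<longleftrightarrow>
     (\<forall>u x. adjacent H u x \<and> \<not> arrowhead_at H x u \<longrightarrow> closed_nbhd H u \<subseteq> closed_nbhd H x)"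

definition nbhds_comparable :: "'v mixed_graph \<Rightarrow> bool" where
  "nbhds_comparable G \<longleftrightarrow>
     (\<forall>v w. adjacent G v w \<longrightarrow>
        closed_nbhd G v \<subseteq> closed_nbhd G w \<or> closed_nbhd G w \<subseteq> closed_nbhd G v)"

text \<open>Vertices may repeat, and \<open>S\<close> confines the walk. Connection given
  \<open>C\<close> in a bi-directed graph becomes connectivity inside \<open>C\<close> together with
  the two endpoints.\<close>

definition walk :: "'v mixed_graph \<Rightarrow> 'v set \<Rightarrow> 'v \<Rightarrow> 'v list \<Rightarrow> 'v \<Rightarrow> bool" where
  "walk G S v p w \<longleftrightarrow>
     p \<noteq> [] \<and> set p \<subseteq> S \<and> successively (adjacent G) p \<and> hd p = v \<and> last p = w"

lemma adjacent_sym: "adjacent G v w \<longleftrightarrow> adjacent G w v"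
  by (auto simp: adjacent_def insert_commute)

lemma closed_nbhd_sym: "v \<in> closed_nbhd G w \<longleftrightarrow> w \<in> closed_nbhd G v"
  by (auto simp: closed_nbhd_def adjacent_sym)

lemma closed_nbhd_cong: "adjacent G = adjacent H \<Longrightarrow> closed_nbhd G = closed_nbhd H"
  by (auto simp: closed_nbhd_def fun_eq_iff)

lemma adjacent_in_closed_nbhd: "adjacent G v w \<Longrightarrow> w \<in> closed_nbhd G v"
  by (simp add: closed_nbhd_def)

section \<open>Edges and edge marks of simple mixed graphs\<close>

lemma simple_unordered_edge:
  assumes "simple_mixed_graph G" "e \<in> undirected_edges G \<union> bidirected_edges G"
  shows "\<exists>v\<in>verts G. \<exists>w\<in>verts G. v \<noteq> w \<and> e = {v, w}"
  using assms unfolding simple_mixed_graph_def by (elim conjE) (rule bspec)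

lemma simple_directed_edge:
  assumes "simple_mixed_graph G" "(v, w) \<in> directed_edges G"
  shows "v \<in> verts G" "w \<in> verts G" "v \<noteq> w" "(w, v) \<notin> directed_edges G"
    "{v, w} \<notin> undirected_edges G" "{v, w} \<notin> bidirected_edges G"
proof -
  have "\<forall>(v, w) \<in> directed_edges G. v \<in> verts G \<and> w \<in> verts G \<and> v \<noteq> w"
    "\<forall>(v, w) \<in> directed_edges G.
       (w, v) \<notin> directed_edges G \<and> {v, w} \<notin> undirected_edges G \<union> bidirected_edges G"
    using assms(1) unfolding simple_mixed_graph_def by simp_all
  from this [THEN bspec, OF assms(2)]
  show "v \<in> verts G" "w \<in> verts G" "v \<noteq> w" "(w, v) \<notin> directed_edges G"
    "{v, w} \<notin> undirected_edges G" "{v, w} \<notin> bidirected_edges G"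
    by simp_all
qed

lemma simple_adjacentD:
  assumes "simple_mixed_graph G" "adjacent G v w"
  shows "v \<in> verts G" "w \<in> verts G" "v \<noteq> w"
proof -
  have "x \<in> verts G \<and> y \<in> verts G \<and> x \<noteq> y"
    if "{x, y} \<in> undirected_edges G \<union> bidirected_edges G" for x y
  proof -
    from simple_unordered_edge [OF assms(1) that]
    obtain a b where "a \<in> verts G" "b \<in> verts G" "a \<noteq> b" "{x, y} = {a, b}"
      by (elim bexE conjE)
    then show ?thesis
      by (auto simp: doubleton_eq_iff)
  qed
  moreover have "x \<in> verts G \<and> y \<in> verts G \<and> x \<noteq> y" if "(x, y) \<in> directed_edges G" for x y
    using simple_directed_edge(1-3) [OF assms(1) that] by simp
  ultimately show "v \<in> verts G" "w \<in> verts G" "v \<noteq> w"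
    using assms(2) unfolding adjacent_def by blast+
qed

lemma simple_finite_edges:
  assumes "simple_mixed_graph G"
  shows "finite (directed_edges G)" "finite (bidirected_edges G)"
proof -
  have fin: "finite (verts G)"
    using assms by (simp add: simple_mixed_graph_def)
  have "directed_edges G \<subseteq> verts G \<times> verts G"
    using simple_directed_edge(1,2) [OF assms] by auto
  then show "finite (directed_edges G)"
    using fin by (meson finite_SigmaI finite_subset)
  have "bidirected_edges G \<subseteq> Pow (verts G)"
    using simple_unordered_edge [OF assms] by blast
  then show "finite (bidirected_edges G)"
    using fin by (meson finite_Pow_iff finite_subset)
qed

lemma directed_edge_no_opposite_arrowhead:
  assumes "simple_mixed_graph G" "(u, v) \<in> directed_edges G"
  shows "\<not> arrowhead_at G v u"
  using simple_directed_edge(4,6) [OF assms] by (simp add: arrowhead_at_def insert_commute)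

lemma undirected_edge_no_arrowhead:
  assumes "simple_mixed_graph G" "{u, v} \<in> undirected_edges G"
  shows "\<not> arrowhead_at G u v" "\<not> arrowhead_at G v u"
proof -
  have "{u, v} \<notin> bidirected_edges G"
    using assms by (auto simp: simple_mixed_graph_def)
  then show "\<not> arrowhead_at G u v" "\<not> arrowhead_at G v u"
    using simple_directed_edge(5) [OF assms(1), of u v] simple_directed_edge(5) [OF assms(1), of v u]
      assms(2)
    by (auto simp: arrowhead_at_def insert_commute)
qed

lemma both_tails_undirected:
  assumes "adjacent G u v" "\<not> arrowhead_at G u v" "\<not> arrowhead_at G v u"
  shows "{u, v} \<in> undirected_edges G"
  using assms by (auto simp: adjacent_def arrowhead_at_def insert_commute)

section \<open>Shortening and building walks\<close>

text \<open>Take a walk of least length: cutting out a loop, or the middle of a triple whose ends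
  are adjacent, would shorten it.\<close>

lemma walk_shortcut:
  assumes "walk G S v p w"
  obtains q where "walk G S v q w" "distinct q"
    "\<And>xs a x b ys. q = xs @ [a, x, b] @ ys \<Longrightarrow> \<not> adjacent G a b"
proof -
  obtain q where q: "walk G S v q w"
    and least: "\<And>q'. walk G S v q' w \<Longrightarrow> length q \<le> length q'"
    using ex_has_least_nat [where P = "\<lambda>q. walk G S v q w" and m = length, OF assms] by blast
  have "distinct q"
  proof (rule ccontr)
    assume "\<not> distinct q"
    then obtain xs ys zs x where eq: "q = xs @ [x] @ ys @ [x] @ zs"
      by (meson not_distinct_decomp)
    then have "walk G S v (xs @ [x] @ zs) w"
      using q by (cases xs) (auto simp: walk_def successively_append_iff successively_Cons hd_append split: if_splits)
    with least eq show False
      by fastforce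
  qed
  moreover have "\<not> adjacent G a b" if eq: "q = xs @ [a, x, b] @ ys" for xs a x b ys
  proof
    assume "adjacent G a b"
    with q eq have "walk G S v (xs @ [a, b] @ ys) w"
      by (cases xs) (auto simp: walk_def successively_append_iff successively_Cons hd_append split: if_splits)
    with least eq show False
      by fastforce
  qed
  ultimately show ?thesis
    using that q by blast
qed

text \<open>Closed neighbourhoods let a step stay put, whereas consecutive vertices of a walk must
  be adjacent; the induction drops such idle steps.\<close>

lemma walk_of_rtrancl:
  assumes "(v, w) \<in> {(x, y). x \<in> S \<and> y \<in> S \<and> y \<in> closed_nbhd G x}\<^sup>*" "v \<in> S"
  shows "\<exists>p. walk G S v p w"
  using assms
proof (induction rule: rtrancl_induct)
  case base
  then have "walk G S v [v] v"
    by (simp add: walk_def)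
  then show ?case ..
next
  case (step y z)
  then obtain p where p: "walk G S v p y"
    by blast
  show ?case
  proof (cases "y = z")
    case False
    then have "walk G S v (p @ [z]) z"
      using step p by (auto simp: walk_def successively_append_iff closed_nbhd_def)
    then show ?thesis ..
  qed (use p in blast)
qed

section \<open>Separation in bi-directed graphs\<close>

lemma bidirected_An: "bidirected_graph G \<Longrightarrow> An G C = C"
  by (auto simp: An_def ancestor_def bidirected_graph_def)

lemma interior_nth:
  assumes "distinct p" "0 < i" "i + 1 < length p"
  shows "p ! i \<noteq> hd p" "p ! i \<noteq> last p"
proof -
  have "p \<noteq> []"
    using assms by auto
  then show "p ! i \<noteq> hd p" "p ! i \<noteq> last p"
    using assms by (auto simp: hd_conv_nth last_conv_nth nth_eq_iff_index_eq)
qed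

lemma path_between_nth:
  assumes "path_between G v p w"
  shows "p ! 0 = v" "p ! (length p - 1) = w"
    and "Suc i < length p \<Longrightarrow> adjacent G (p ! i) (p ! Suc i)"
    and "v \<noteq> w \<Longrightarrow> Suc 0 < length p"
proof -
  have p: "p \<noteq> []" "hd p = v" "last p = w" "successively (adjacent G) p"
    using assms by (auto simp: path_between_def)
  then show "p ! 0 = v" "p ! (length p - 1) = w"
    by (auto simp: hd_conv_nth last_conv_nth)
  show "adjacent G (p ! i) (p ! Suc i)" if "Suc i < length p"
    using p that by (auto intro: successively_nth)
  show "Suc 0 < length p" if "v \<noteq> w"
    using p that by (cases p; cases "tl p") auto
qed

lemma interior_subset_iff:
  assumes "path_between G v p w"
  shows "(\<forall>i. 0 < i \<and> i + 1 < length p \<longrightarrow> p ! i \<in> C) \<longleftrightarrow> set p \<subseteq> C \<union> {v, w}"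
proof
  assume int: "\<forall>i. 0 < i \<and> i + 1 < length p \<longrightarrow> p ! i \<in> C"
  show "set p \<subseteq> C \<union> {v, w}"
  proof
    fix x assume "x \<in> set p"
    then obtain i where i: "i < length p" "x = p ! i"
      by (auto simp: in_set_conv_nth)
    consider "i = 0" | "i = length p - 1" | "0 < i" "i + 1 < length p"
      using i by linarith
    then show "x \<in> C \<union> {v, w}"
      using assms int i
      by cases (auto simp: path_between_def hd_conv_nth last_conv_nth)
  qed
next
  assume sub: "set p \<subseteq> C \<union> {v, w}"
  show "\<forall>i. 0 < i \<and> i + 1 < length p \<longrightarrow> p ! i \<in> C"
  proof (intro allI impI, elim conjE)
    fix i assume i: "0 < i" "i + 1 < length p"
    then have "p ! i \<in> set p"
      by simp
    moreover have "p ! i \<noteq> v" "p ! i \<noteq> w"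
      using interior_nth [OF _ i] assms by (auto simp: path_between_def)
    ultimately show "p ! i \<in> C"
      using sub by blast
  qed
qed

text \<open>Every interior vertex is a collider, and \<open>An G C = C\<close> because there are no
  directed edges.\<close>

lemma bidirected_m_connecting_iff:
  assumes G: "bidirected_graph G" and p: "path_between G v p w"
  shows "m_connecting G p C \<longleftrightarrow> set p \<subseteq> C \<union> {v, w}"
proof -
  have "collider G p i" if "0 < i" "i + 1 < length p" for i
  proof -
    have "adjacent G (p ! (i - 1)) (p ! i)" "adjacent G (p ! i) (p ! (i + 1))"
      using path_between_nth(3) [OF p, of "i - 1"] path_between_nth(3) [OF p, of i] that by auto
    then show ?thesis
      using G by (auto simp: collider_def arrowhead_at_def adjacent_def bidirected_graph_def
          insert_commute)
  qed
  then show ?thesis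
    using interior_subset_iff [OF p, of C] bidirected_An [OF G]
    by (auto simp: m_connecting_def)
qed

text \<open>Removing repetitions from a walk keeps it inside the same vertex set, so walks may
  replace paths.\<close>

lemma bidirected_separated_iff:
  assumes "bidirected_graph G" "v \<in> verts G" "w \<in> verts G" "C \<subseteq> verts G"
  shows "m_separated_verts G v w C \<longleftrightarrow> (\<nexists>p. walk G (C \<union> {v, w}) v p w)"
proof -
  have "\<exists>p. path_between G v p w \<and> m_connecting G p C" if "walk G (C \<union> {v, w}) v p w" for p
  proof -
    from that obtain q where q: "walk G (C \<union> {v, w}) v q w" "distinct q"
      by (rule walk_shortcut)
    then have sub: "set q \<subseteq> C \<union> {v, w}"
      by (simp add: walk_def)
    moreover have "C \<union> {v, w} \<subseteq> verts G"
      using assms by simp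
    ultimately have "set q \<subseteq> verts G"
      by (rule subset_trans)
    then have "path_between G v q w"
      using q by (simp add: walk_def path_between_def)
    then show ?thesis
      using bidirected_m_connecting_iff [OF assms(1), of v q w C] sub by blast
  qed
  moreover have "walk G (C \<union> {v, w}) v p w" if "path_between G v p w" "m_connecting G p C" for p
    using that bidirected_m_connecting_iff [OF assms(1) that(1), of C]
    by (simp add: walk_def path_between_def)
  ultimately show ?thesis
    unfolding m_separated_verts_def by blast
qed

lemma adjacent_not_separated:
  assumes "simple_mixed_graph G" "adjacent G v w"
  shows "\<not> m_separated_verts G v w C"
proof -
  have "path_between G v [v, w] w"
    using assms simple_adjacentD [OF assms] by (auto simp: path_between_def)
  moreover have "m_connecting G [v, w] C"
    by (auto simp: m_connecting_def)
  ultimately show ?thesis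
    by (auto simp: m_separated_verts_def)
qed

text \<open>A walk confined to \<open>{v, w}\<close> has to use an edge between them. Thus the empty
  set separates every non-adjacent pair.\<close>

lemma bidirected_nonadjacent_separated:
  assumes "bidirected_graph G" "v \<in> verts G" "w \<in> verts G" "v \<noteq> w" "\<not> adjacent G v w"
  shows "m_separated_verts G v w {}"
proof -
  have "\<not> walk G {v, w} v p w" for p
  proof
    assume "walk G {v, w} v p w"
    then obtain q where q: "walk G {v, w} v q w" "distinct q"
      by (rule walk_shortcut)
    then have "q \<noteq> []" "hd q = v" "last q = w" "successively (adjacent G) q" "set q \<subseteq> {v, w}"
      by (auto simp: walk_def)
    then obtain q' where "q = v # q'"
      by (cases q) auto
    moreover have "q' \<noteq> []"
      using calculation \<open>last q = w\<close> assms(4) by auto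
    moreover have "set q' \<subseteq> {w}"
      using q calculation by (auto simp: walk_def)
    ultimately show False
      using q assms(5) by (cases q') (auto simp: walk_def)
  qed
  then show ?thesis
    using bidirected_separated_iff [OF assms(1-3)] by simp
qed

section \<open>Sufficient condition for equivalence to a bi-directed graph\<close>

text \<open>Each edge of a directed path has its tail at the source, so the inclusions
  compose.\<close>

lemma ancestor_closed_nbhd:
  assumes "simple_mixed_graph H" "tails_respect_nbhds H" "ancestor H u x"
  shows "closed_nbhd H u \<subseteq> closed_nbhd H x"
proof -
  have "(u, x) \<in> (directed_edges H)\<^sup>*"
    using assms(3) by (simp add: ancestor_def)
  then show ?thesis
  proof (induction rule: rtrancl_induct)
    case (step y z)
    have "\<not> arrowhead_at H z y"
      using directed_edge_no_opposite_arrowhead assms(1) step(2) .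
    moreover have "adjacent H y z"
      using step(2) by (simp add: adjacent_def)
    ultimately show ?case
      using step assms(2) unfolding tails_respect_nbhds_def by blast
  qed simp
qed

text \<open>Scan the path while keeping a vertex \<open>k\<close> reachable through \<open>C\<close>: non-colliders are skipped, a
  collider is replaced by a descendant in \<open>C\<close>. The last conjunct of the invariant lets a non-collider
  with its tail pointing backwards be skipped.\<close>

lemma m_connecting_imp_walk:
  assumes H: "ancestral H" "tails_respect_nbhds H"
    and p: "path_between H v p w" "m_connecting H p C" and "v \<noteq> w"
  shows "\<exists>q. walk H (C \<union> {v, w}) v q w"
proof -
  let ?N = "closed_nbhd H"
  \<comment> \<open>\<open>?R\<close> is reflexive on \<open>C \<union> {v, w}\<close>; this covers
    a collider whose chosen descendant is the vertex already held.\<close>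
  let ?R = "{(x, y). x \<in> C \<union> {v, w} \<and> y \<in> C \<union> {v, w} \<and> y \<in> ?N x}"
  have simple: "simple_mixed_graph H"
    using H by (simp add: ancestral_def)
  have tail: "?N a \<subseteq> ?N b" if "adjacent H a b" "\<not> arrowhead_at H b a" for a b
    using H that by (auto simp: tails_respect_nbhds_def)
  have adj: "adjacent H (p ! i) (p ! Suc i)" if "Suc i < length p" for i
    using path_between_nth(3) [OF p(1) that] .
  have len: "Suc 0 < length p"
    using path_between_nth(4) [OF p(1) \<open>v \<noteq> w\<close>] .
  have p0: "p ! 0 = v" and pn: "p ! (length p - 1) = w"
    using path_between_nth(1,2) [OF p(1)] .
  have reach: "\<exists>k \<in> C \<union> {v, w}. (v, k) \<in> ?R\<^sup>* \<and> k \<in> ?N (p ! Suc i) \<and>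
      (\<not> arrowhead_at H (p ! i) (p ! Suc i) \<longrightarrow> ?N (p ! Suc i) \<subseteq> ?N k)"
    if "Suc i < length p" for i
    using that
  proof (induction i)
    case 0
    show ?case
    proof (rule bexI [of _ v], intro conjI impI)
      show "v \<in> ?N (p ! Suc 0)"
        using adj [OF len] p0 by (simp add: closed_nbhd_def adjacent_sym)
      show "?N (p ! Suc 0) \<subseteq> ?N v" if "\<not> arrowhead_at H (p ! 0) (p ! Suc 0)"
        using tail [of "p ! Suc 0" "p ! 0"] adj [OF len] adjacent_sym [of H "p ! 0"] that p0
        by simp
    qed simp_all
  next
    case (Suc i)
    let ?a = "p ! i" and ?b = "p ! Suc i" and ?c = "p ! Suc (Suc i)"
    obtain k where k: "k \<in> C \<union> {v, w}" "(v, k) \<in> ?R\<^sup>*" "k \<in> ?N ?b"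
      and k_tail: "\<not> arrowhead_at H ?a ?b \<Longrightarrow> ?N ?b \<subseteq> ?N k"
      using Suc by auto
    have bc: "adjacent H ?b ?c"
      using adj Suc.prems by simp
    have c_tail: "?N ?c \<subseteq> ?N ?b" if "\<not> arrowhead_at H ?b ?c"
      using tail that bc adjacent_sym by metis
    have status: "if collider H p (Suc i) then ?b \<in> An H C else ?b \<notin> C"
      using p(2) Suc.prems by (auto simp: m_connecting_def)
    consider "collider H p (Suc i)" | "\<not> arrowhead_at H ?a ?b"
      | "arrowhead_at H ?a ?b" "\<not> arrowhead_at H ?c ?b"
      by (auto simp: collider_def)
    then show ?case
    proof cases
      \<comment> \<open>The descendant \<open>d\<close> of the collider inherits all its neighbours,
        so it is within one step of both \<open>k\<close> and the next vertex.\<close>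
      case 1
      then obtain d where d: "d \<in> C" "ancestor H ?b d"
        using status by (auto simp: An_def)
      have sub: "?N ?b \<subseteq> ?N d"
        using ancestor_closed_nbhd [OF simple H(2) d(2)] .
      then have "(k, d) \<in> ?R"
        using k d closed_nbhd_sym [of k H d] by auto
      with k(2) have "(v, d) \<in> ?R\<^sup>*"
        by (rule rtrancl_into_rtrancl)
      moreover have "?c \<in> ?N d"
        using adjacent_in_closed_nbhd [OF bc] sub by (rule rev_subsetD)
      then have "d \<in> ?N ?c"
        using closed_nbhd_sym [of d H ?c] by simp
      moreover have "?N ?c \<subseteq> ?N d" if "\<not> arrowhead_at H ?b ?c"
        using c_tail [OF that] sub by (rule subset_trans)
      ultimately show ?thesis
        using d by (intro bexI [of _ d] conjI impI) simp_all
    next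
      case 2
      have "?c \<in> ?N k"
        using adjacent_in_closed_nbhd [OF bc] k_tail [OF 2] by (rule rev_subsetD)
      then have "k \<in> ?N ?c"
        using closed_nbhd_sym [of k H ?c] by simp
      moreover have "?N ?c \<subseteq> ?N k" if "\<not> arrowhead_at H ?b ?c"
        using c_tail [OF that] k_tail [OF 2] by (rule subset_trans)
      ultimately show ?thesis
        using k by (intro bexI [of _ k] conjI impI) simp_all
    next
      \<comment> \<open>No arrowhead meets an undirected edge, so the edge leaving \<open>?b\<close>
        has an arrowhead at \<open>?c\<close>. The last conjunct is then vacuous, and the tail at
        \<open>?b\<close> carries \<open>k\<close> over to \<open>?N ?c\<close>.\<close>
      case 3
      then have "{?b, ?c} \<notin> undirected_edges H"
        using H by (auto simp: ancestral_def)
      then have "arrowhead_at H ?b ?c"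
        using both_tails_undirected [OF bc] 3 by auto
      moreover have "k \<in> ?N ?c"
        using k(3) tail [OF bc 3(2)] by (rule rev_subsetD)
      ultimately show ?thesis
        using k by (intro bexI [of _ k] conjI impI) simp_all
    qed
  qed
  \<comment> \<open>The invariant concerns position \<open>Suc i\<close>, so
    \<open>i = length p - 2\<close> reaches the final vertex; \<open>len\<close> makes the
    subtraction exact.\<close>
  have idx: "Suc (length p - 2) < length p" "p ! Suc (length p - 2) = w"
    using len pn by (auto simp: Suc_diff_Suc numeral_2_eq_2)
  from reach [OF idx(1)] obtain k
    where k: "k \<in> C \<union> {v, w}" "(v, k) \<in> ?R\<^sup>*" "k \<in> ?N w"
    unfolding idx(2) by blast
  then have "(k, w) \<in> ?R"
    using closed_nbhd_sym [of k H w] by auto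
  with k(2) have "(v, w) \<in> ?R\<^sup>*"
    by (rule rtrancl_into_rtrancl)
  then show ?thesis
    by (rule walk_of_rtrancl) simp
qed

text \<open>On a chordless walk every interior vertex is a collider: a tail at \<open>?x\<close>
  towards one neighbour makes the other one adjacent to it, giving a chord. The interior lies in
  \<open>C\<close>, hence in \<open>An H C\<close>.\<close>

lemma walk_imp_m_connecting:
  assumes H: "ancestral H" "tails_respect_nbhds H"
    and C: "C \<subseteq> verts H" "v \<in> verts H" "w \<in> verts H"
    and "walk H (C \<union> {v, w}) v q w"
  shows "\<exists>p. path_between H v p w \<and> m_connecting H p C"
proof -
  obtain p where p: "walk H (C \<union> {v, w}) v p w" "distinct p"
    and no_chord: "\<And>xs a x b ys. p = xs @ [a, x, b] @ ys \<Longrightarrow> \<not> adjacent H a b"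
    using walk_shortcut [OF assms(6)] by blast
  have path: "path_between H v p w"
    using p C by (auto simp: walk_def path_between_def)
  have sub: "set p \<subseteq> C \<union> {v, w}"
    using p by (simp add: walk_def)
  have coll: "collider H p i" if i: "0 < i" "i + 1 < length p" for i
  proof (rule ccontr)
    let ?a = "p ! (i - 1)" and ?x = "p ! i" and ?b = "p ! (i + 1)"
    assume "\<not> collider H p i"
    then consider "\<not> arrowhead_at H ?a ?x" | "\<not> arrowhead_at H ?b ?x"
      by (auto simp: collider_def)
    moreover have ax: "adjacent H ?a ?x" and xb: "adjacent H ?x ?b"
      using path_between_nth(3) [OF path, of "i - 1"] path_between_nth(3) [OF path, of i] i by auto
    ultimately have "?b \<in> closed_nbhd H ?a"
      using H(2) adjacent_sym [of H] closed_nbhd_sym [of _ H]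
      unfolding tails_respect_nbhds_def by (metis adjacent_in_closed_nbhd subsetD)
    moreover have "?a \<noteq> ?b"
      using p(2) i by (auto simp: nth_eq_iff_index_eq)
    ultimately have "adjacent H ?a ?b"
      by (auto simp: closed_nbhd_def)
    moreover have "p = take (i - 1) p @ [?a, ?x, ?b] @ drop (i + 2) p"
      using i id_take_nth_drop [of "i - 1" p] Cons_nth_drop_Suc [of i p]
        Cons_nth_drop_Suc [of "i + 1" p] by auto
    ultimately show False
      using no_chord by blast
  qed
  have "C \<subseteq> An H C"
    by (auto simp: An_def ancestor_def)
  then have "m_connecting H p C"
    using coll interior_subset_iff [OF path, of C] sub by (auto simp: m_connecting_def)
  with path show ?thesis
    by blast
qed

text \<open>Connection in either graph amounts to the existence of a walk, and walks depend on
  adjacency alone.\<close>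

lemma markov_equivalent_bidirectedI:
  assumes G: "bidirected_graph G" and H: "ancestral H" "verts H = verts G"
    and adj: "adjacent H = adjacent G" and tails: "tails_respect_nbhds H"
  shows "markov_equivalent G H"
proof -
  have walk_eq: "walk H = walk G"
    using adj by (auto simp: walk_def fun_eq_iff)
  have "m_separated_verts G v w C \<longleftrightarrow> m_separated_verts H v w C"
    if "v \<in> verts G" "w \<in> verts G" "v \<noteq> w" "C \<subseteq> verts G" for v w C
  proof -
    have "(\<exists>p. path_between H v p w \<and> m_connecting H p C) \<longleftrightarrow> (\<exists>p. walk H (C \<union> {v, w}) v p w)"
      using m_connecting_imp_walk [OF H(1) tails] walk_imp_m_connecting [OF H(1) tails] that H(2)
      by metis
    then show ?thesis
      using bidirected_separated_iff [OF G] that walk_eq by (auto simp: m_separated_verts_def)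
  qed
  then have "m_separated G A B C \<longleftrightarrow> m_separated H A B C" for A B C
    unfolding m_separated_def H(2) by blast
  then show ?thesis
    using bidirected_graph_ancestral [OF G] H by (simp add: markov_equivalent_def)
qed

section \<open>Necessary conditions for equivalence to a bi-directed graph\<close>

lemma markov_equivalent_separated_verts:
  assumes "markov_equivalent G H" "v \<in> verts G" "w \<in> verts G" "v \<noteq> w" "C \<subseteq> verts G - {v, w}"
  shows "m_separated_verts G v w C \<longleftrightarrow> m_separated_verts H v w C"
proof -
  have "m_separated G {v} {w} C \<longleftrightarrow> m_separated H {v} {w} C" "verts H = verts G"
    using assms by (auto simp: markov_equivalent_def)
  then show ?thesis
    using assms by (auto simp: m_separated_def)
qed

text \<open>Adjacent vertices are never separated, and non-adjacent ones are separated by some set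
  in both graphs. The premise on separators serves maximal graphs and DAGs alike; its disjunction
  fits DAGs, where the parents of one suitable end are used.\<close>

lemma markov_equivalent_bidirected_adjacent:
  assumes G: "bidirected_graph G" and eqv: "markov_equivalent G H"
    and separator: "\<And>v w. v \<in> verts H \<Longrightarrow> w \<in> verts H \<Longrightarrow> v \<noteq> w \<Longrightarrow> \<not> adjacent H v w \<Longrightarrow>
      \<exists>C \<subseteq> verts H - {v, w}. m_separated_verts H v w C \<or> m_separated_verts H w v C"
  shows "adjacent H = adjacent G"
proof (intro ext iffI)
  fix v w
  have simple: "simple_mixed_graph G" "simple_mixed_graph H" and verts: "verts H = verts G"
    using eqv by (auto simp: markov_equivalent_def ancestral_def)
  show "adjacent G v w" if "adjacent H v w"
  proof (rule ccontr)
    assume "\<not> adjacent G v w"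
    moreover have vw: "v \<in> verts G" "w \<in> verts G" "v \<noteq> w"
      using simple_adjacentD [OF simple(2) that] verts by auto
    ultimately have "m_separated_verts H v w {}"
      using bidirected_nonadjacent_separated [OF G]
        markov_equivalent_separated_verts [OF eqv, of v w "{}"] by simp
    then show False
      using adjacent_not_separated [OF simple(2) that] by blast
  qed
  show "adjacent H v w" if "adjacent G v w"
  proof (rule ccontr)
    assume nadj: "\<not> adjacent H v w"
    have vw: "v \<in> verts G" "w \<in> verts G" "v \<noteq> w"
      using simple_adjacentD [OF simple(1) that] by auto
    then obtain C where C: "C \<subseteq> verts G - {v, w}"
      "m_separated_verts H v w C \<or> m_separated_verts H w v C"
      using separator nadj verts by metis
    then have "m_separated_verts G v w C \<or> m_separated_verts G w v C"
      using markov_equivalent_separated_verts [OF eqv, of v w C]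
        markov_equivalent_separated_verts [OF eqv, of w v C] vw by (auto simp: insert_commute)
    then show False
      using adjacent_not_separated [OF simple(1)] that adjacent_sym [of G v w] by blast
  qed
qed

text \<open>An unshielded non-collider would connect, given the empty set, two vertices that are separated
  given the empty set in the bi-directed graph.\<close>

lemma markov_equivalent_bidirected_tails:
  assumes G: "bidirected_graph G" and eqv: "markov_equivalent G H"
    and adj: "adjacent H = adjacent G"
  shows "tails_respect_nbhds H"
  unfolding tails_respect_nbhds_def
proof (intro allI impI subsetI)
  fix u x y
  assume ux: "adjacent H u x \<and> \<not> arrowhead_at H x u" and y: "y \<in> closed_nbhd H u"
  have simple: "simple_mixed_graph H" and verts: "verts H = verts G"
    using eqv by (auto simp: markov_equivalent_def ancestral_def)
  show "y \<in> closed_nbhd H x"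
  proof (rule ccontr)
    assume "y \<notin> closed_nbhd H x"
    then have nadj: "\<not> adjacent H x y" "x \<noteq> y"
      by (auto simp: closed_nbhd_def)
    then have uy: "adjacent H u y"
      using y ux adjacent_sym [of H] by (auto simp: closed_nbhd_def)
    have distinct: "u \<in> verts H" "x \<in> verts H" "y \<in> verts H" "u \<noteq> x" "u \<noteq> y"
      using simple_adjacentD [OF simple] ux uy by auto
    then have "m_separated_verts H x y {}"
      using markov_equivalent_separated_verts [OF eqv, of x y "{}"]
        bidirected_nonadjacent_separated [OF G, of x y] nadj adj verts by simp
    moreover have "path_between H x [x, u, y] y"
      using distinct nadj ux uy adjacent_sym [of H x u] by (auto simp: path_between_def)
    moreover have "m_connecting H [x, u, y] {}"
      using ux by (auto simp: m_connecting_def collider_def less_Suc_eq)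
    ultimately show False
      by (auto simp: m_separated_verts_def)
  qed
qed

section \<open>Separation in directed acyclic graphs\<close>

text \<open>The parents of \<open>v\<close> separate \<open>v\<close> from a non-adjacent non-descendant: a connecting path would have
  to leave \<open>v\<close> along a directed path that never meets a collider.\<close>

lemma dag_parents_separate:
  assumes D: "dag D" and nadj: "\<not> adjacent D v w" and nanc: "\<not> ancestor D v w"
  shows "m_separated_verts D v w {u. (u, v) \<in> directed_edges D}"
  unfolding m_separated_verts_def
proof (rule notI, elim exE conjE)
  let ?E = "directed_edges D"
  let ?P = "{u. (u, v) \<in> ?E}"
  fix p assume path: "path_between D v p w" and conn: "m_connecting D p ?P"
  have simple: "simple_mixed_graph D" and acyclic: "acyclic ?E"
    and edges: "undirected_edges D = {}" "bidirected_edges D = {}"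
    using D by (auto simp: dag_def directed_graph_def)
  have head: "arrowhead_at D a b \<longleftrightarrow> (a, b) \<in> ?E" for a b
    using edges by (simp add: arrowhead_at_def)
  have "v \<noteq> w"
    using nanc by (auto simp: ancestor_def)
  have adj: "adjacent D (p ! i) (p ! Suc i)" if "Suc i < length p" for i
    using path_between_nth(3) [OF path that] .
  have len: "Suc 0 < length p"
    using path_between_nth(4) [OF path \<open>v \<noteq> w\<close>] .
  have p0: "p ! 0 = v" and pn: "p ! (length p - 1) = w"
    using path_between_nth(1,2) [OF path] .
  have status: "if collider D p (Suc i) then p ! Suc i \<in> An D ?P else p ! Suc i \<notin> ?P"
    if "Suc (Suc i) < length p" for i
    using conn that by (auto simp: m_connecting_def)
  \<comment> \<open>A proper descendant of \<open>v\<close> that is also an ancestor of a parent of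
    \<open>v\<close> closes a directed cycle.\<close>
  have cycle: False if desc: "(v, x) \<in> ?E\<^sup>+" and anc: "x \<in> An D ?P" for x
  proof -
    obtain u where "(u, v) \<in> ?E" "(x, u) \<in> ?E\<^sup>*"
      using anc by (auto simp: An_def ancestor_def)
    then have "(v, v) \<in> ?E\<^sup>+"
      using desc by (meson rtrancl_into_trancl1 trancl_trans)
    then show False
      using acyclic by (auto simp: acyclic_def)
  qed
  have "(v, p ! Suc i) \<in> ?E\<^sup>+ \<and> (p ! i, p ! Suc i) \<in> ?E" if "Suc i < length p" for i
    using that
  proof (induction i)
    case 0
    \<comment> \<open>If the first edge pointed into \<open>v\<close>, the second vertex would be a
      parent of \<open>v\<close>, hence different from \<open>w\<close> and a non-collider blocked
      by \<open>?P\<close>.\<close>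
    have "(p ! Suc 0, v) \<notin> ?E"
    proof
      assume e: "(p ! Suc 0, v) \<in> ?E"
      then have "p ! Suc 0 \<noteq> w"
        using nadj by (auto simp: adjacent_def)
      then have long: "Suc (Suc 0) < length p"
        using len pn by (cases "length p = 2") auto
      have "\<not> collider D p (Suc 0)"
        using simple_directed_edge(4) [OF simple e] p0 by (simp add: collider_def head)
      then show False
        using status [OF long] e by simp
    qed
    then show ?case
      using adj [OF len] p0 edges by (auto simp: adjacent_def)
  next
    case (Suc i)
    then have IH: "(v, p ! Suc i) \<in> ?E\<^sup>+" "(p ! i, p ! Suc i) \<in> ?E"
      by auto
    \<comment> \<open>By \<open>cycle\<close>, a descendant of \<open>v\<close> cannot be an open
      collider. As the preceding edge points forward, the next one must as well.\<close>
    then have "\<not> collider D p (Suc i)"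
      using cycle status [OF Suc.prems] by auto
    then have "(p ! Suc (Suc i), p ! Suc i) \<notin> ?E"
      using IH(2) by (simp add: collider_def head)
    then have "(p ! Suc i, p ! Suc (Suc i)) \<in> ?E"
      using adj [OF Suc.prems] edges by (auto simp: adjacent_def)
    with IH(1) show ?case
      by auto
  qed
  from this [of "length p - 2"] have "(v, w) \<in> ?E\<^sup>+"
    using len pn by (auto simp: Suc_diff_Suc numeral_2_eq_2)
  then show False
    using nanc by (auto simp: ancestor_def dest: trancl_into_rtrancl)
qed

text \<open>By acyclicity one of the two vertices is not an ancestor of the other, and its parents
  separate them.\<close>

lemma dag_nonadjacent_separated:
  assumes D: "dag D" and vw: "v \<noteq> w" "\<not> adjacent D v w"
  shows "\<exists>C \<subseteq> verts D - {v, w}. m_separated_verts D v w C \<or> m_separated_verts D w v C"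
proof -
  have simple: "simple_mixed_graph D"
    using D by (simp add: dag_def directed_graph_def)
  have parents: "{u. (u, x) \<in> directed_edges D} \<subseteq> verts D - {x, y}"
    if "\<not> adjacent D x y" for x y
    using that simple_directed_edge(1,3) [OF simple] by (auto simp: adjacent_def)
  have "\<not> ancestor D v w \<or> \<not> ancestor D w v"
    using D vw acyclic_impl_antisym_rtrancl [of "directed_edges D"]
    by (auto simp: dag_def ancestor_def dest: antisymD)
  then show ?thesis
    using dag_parents_separate [OF D] parents [of v w] parents [of w v] vw adjacent_sym [of D v w]
    by (metis insert_commute)
qed

section \<open>Orienting edges by neighbourhood inclusion\<close>

text \<open>The injective \<open>f\<close> breaks ties between equal neighbourhoods; \<open>U\<close> holds the vertices at which such
  ties stay undirected. \<open>U = {}\<close> gives a DAG, \<open>U = minimal_nbhd_verts G\<close> the fewest arrowheads.\<close>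

definition oriented_by_nbhds :: "'v mixed_graph \<Rightarrow> ('v \<Rightarrow> nat) \<Rightarrow> 'v set \<Rightarrow> 'v mixed_graph" where
  "oriented_by_nbhds G f U =
     \<lparr>verts = verts G,
      undirected_edges =
        {{v, w} |v w. adjacent G v w \<and> closed_nbhd G v = closed_nbhd G w \<and> v \<in> U},
      directed_edges =
        {(v, w). adjacent G v w \<and> (closed_nbhd G v \<subset> closed_nbhd G w \<or>
           closed_nbhd G v = closed_nbhd G w \<and> v \<notin> U \<and> f v < f w)},
      bidirected_edges = {}\<rparr>"

text \<open>At any other vertex some neighbour has a strictly smaller neighbourhood, and
  \<open>tails_respect_nbhds\<close> forces an arrowhead from it.\<close>

definition minimal_nbhd_verts :: "'v mixed_graph \<Rightarrow> 'v set" where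
  "minimal_nbhd_verts G = {v. \<forall>u. adjacent G u v \<longrightarrow> \<not> closed_nbhd G u \<subset> closed_nbhd G v}"

context
  fixes G :: "'v mixed_graph" and f :: "'v \<Rightarrow> nat" and U :: "'v set" and H :: "'v mixed_graph"
  assumes G: "bidirected_graph G" and comparable: "nbhds_comparable G"
    and f: "inj_on f (verts G)" and U: "U = {} \<or> U = minimal_nbhd_verts G"
  defines "H \<equiv> oriented_by_nbhds G f U"
begin

private abbreviation (input) "N \<equiv> closed_nbhd G"

private lemma simple_G: "simple_mixed_graph G"
  using G by (simp add: bidirected_graph_def)

text \<open>An unordered pair fixes no order of its ends, so membership in \<open>U\<close> must
  pass across a tie. It does: adjacent vertices with equal closed neighbourhoods see the same
  smaller neighbours.\<close>

private lemma undirected_iff: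
  "{v, w} \<in> undirected_edges H \<longleftrightarrow> adjacent G v w \<and> N v = N w \<and> v \<in> U"
proof -
  have "w \<in> U" if "adjacent G v w" "N v = N w" "v \<in> U" for v w
  proof -
    have U': "U = minimal_nbhd_verts G"
      using U that by auto
    moreover have "\<not> N u \<subset> N w" if "adjacent G u w" for u
    proof (cases "u = v")
      case False
      have "u \<in> N v"
        using adjacent_in_closed_nbhd [OF that] closed_nbhd_sym [of u] \<open>N v = N w\<close> by simp
      then have "adjacent G u v"
        using False by (simp add: closed_nbhd_def adjacent_sym)
      then show ?thesis
        using \<open>v \<in> U\<close> \<open>N v = N w\<close> by (simp add: U' minimal_nbhd_verts_def)
    qed (use \<open>N v = N w\<close> in simp)
    ultimately show ?thesis
      by (auto simp: minimal_nbhd_verts_def)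
  qed
  then show ?thesis
    by (auto simp: H_def oriented_by_nbhds_def doubleton_eq_iff adjacent_sym)
qed

private lemma directed_iff:
  "(v, w) \<in> directed_edges H \<longleftrightarrow>
     adjacent G v w \<and> (N v \<subset> N w \<or> N v = N w \<and> v \<notin> U \<and> f v < f w)"
  by (simp add: H_def oriented_by_nbhds_def)

private lemma bidirected_empty: "bidirected_edges H = {}" and verts_H: "verts H = verts G"
  by (simp_all add: H_def oriented_by_nbhds_def)

text \<open>Comparability leaves strict inclusion or a tie; a tie is undirected within
  \<open>U\<close> and otherwise oriented by \<open>f\<close>, which differs at the two
  ends.\<close>

private lemma adjacent_H: "adjacent H = adjacent G"
proof (intro ext)
  fix v w
  have "f v \<noteq> f w" if "adjacent G v w"
    using simple_adjacentD [OF simple_G that] f by (auto simp: inj_on_def)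
  moreover have "N v \<subseteq> N w \<or> N w \<subseteq> N v" if "adjacent G v w"
    using comparable that by (auto simp: nbhds_comparable_def)
  ultimately show "adjacent H v w \<longleftrightarrow> adjacent G v w"
    using undirected_iff [of v w] undirected_iff [of w v] adjacent_sym [of G v w]
    unfolding adjacent_def [of H] directed_iff bidirected_empty insert_commute [of w v]
    by (metis empty_iff nat_neq_iff psubsetI)
qed

private lemma simple_H: "simple_mixed_graph H"
proof -
  have "\<exists>v\<in>verts G. \<exists>w\<in>verts G. v \<noteq> w \<and> e = {v, w}" if "e \<in> undirected_edges H" for e
  proof -
    obtain v w where "adjacent G v w" "e = {v, w}"
      using \<open>e \<in> undirected_edges H\<close> by (auto simp: H_def oriented_by_nbhds_def)
    then show ?thesis
      using simple_adjacentD [OF simple_G \<open>adjacent G v w\<close>] by blast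
  qed
  moreover have "v \<in> verts G \<and> w \<in> verts G \<and> v \<noteq> w \<and> (w, v) \<notin> directed_edges H \<and>
      {v, w} \<notin> undirected_edges H" if "(v, w) \<in> directed_edges H" for v w
    using that simple_adjacentD [OF simple_G, of v w]
    unfolding directed_iff undirected_iff by auto
  moreover have "finite (verts G)"
    using simple_G by (simp add: simple_mixed_graph_def)
  ultimately show ?thesis
    by (auto simp: simple_mixed_graph_def verts_H bidirected_empty)
qed

text \<open>Directed edges increase the pair of neighbourhood and \<open>f\<close> value in a strict
  lexicographic order.\<close>

private lemma acyclic_H: "acyclic (directed_edges H)"
proof -
  let ?R = "{(v, w). N v \<subset> N w \<or> N v = N w \<and> f v < f w}"
  have "trans ?R"
    by (rule transI) auto
  then have "acyclic ?R"
    by (auto simp: acyclic_def)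
  then show ?thesis
    by (rule acyclic_subset) (auto simp: directed_iff)
qed

lemma oriented_by_nbhds_ancestral: "ancestral H"
proof -
  have "\<not> arrowhead_at H u v" if "{v, w} \<in> undirected_edges H" for u v w
  proof
    assume "arrowhead_at H u v"
    then have uv: "(u, v) \<in> directed_edges H"
      by (simp add: arrowhead_at_def bidirected_empty)
    have "v \<in> U"
      using that by (simp add: undirected_iff)
    then have "U = minimal_nbhd_verts G"
      using U by auto
    \<comment> \<open>Minimality of \<open>v\<close> rules out a strictly smaller
      \<open>N u\<close>, so the arrowhead comes from a tie with \<open>u\<close> outside
      \<open>U\<close>; but a tie with \<open>v\<close> puts \<open>u\<close> into
      \<open>U\<close>.\<close>
    then have eq: "N u = N v" "u \<notin> U" "adjacent G u v"
      using uv \<open>v \<in> U\<close> by (auto simp: directed_iff minimal_nbhd_verts_def)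
    then have "{v, u} \<in> undirected_edges H"
      using \<open>v \<in> U\<close> adjacent_sym [of G u v] by (simp add: undirected_iff)
    then have "{u, v} \<in> undirected_edges H"
      by (simp add: insert_commute)
    then show False
      using eq by (simp add: undirected_iff)
  qed
  then show ?thesis
    using simple_H acyclic_H by (auto simp: ancestral_def bidirected_empty)
qed

lemma oriented_by_nbhds_markov_equivalent: "markov_equivalent G H"
proof (rule markov_equivalent_bidirectedI [OF G oriented_by_nbhds_ancestral verts_H adjacent_H])
  have "N u \<subseteq> N x" if "adjacent H u x" "\<not> arrowhead_at H x u" for u x
    using that undirected_iff [of u x] directed_iff [of u x]
    by (auto simp: adjacent_def arrowhead_at_def bidirected_empty)
  then show "tails_respect_nbhds H"
    by (simp add: tails_respect_nbhds_def closed_nbhd_cong [OF adjacent_H])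
qed

text \<open>Equivalence transfers the empty separating set from \<open>G\<close>.\<close>

lemma oriented_by_nbhds_maximal: "maximal_ancestral H"
proof -
  have "m_separated_verts H v w {}"
    if "v \<in> verts G" "w \<in> verts G" "v \<noteq> w" "\<not> adjacent G v w" for v w
    using bidirected_nonadjacent_separated [OF G that]
      markov_equivalent_separated_verts [OF oriented_by_nbhds_markov_equivalent, of v w "{}"] that
    by simp
  then show ?thesis
    using oriented_by_nbhds_ancestral
    by (auto simp: maximal_ancestral_def verts_H adjacent_H)
qed

lemma oriented_by_nbhds_dag: "U = {} \<Longrightarrow> dag H"
  using simple_H acyclic_H
  by (auto simp: dag_def directed_graph_def bidirected_empty H_def oriented_by_nbhds_def)

text \<open>Forgetting direction embeds the directed edges of \<open>H\<close> into the edges of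
  \<open>K\<close> that carry an arrowhead. The bound counts each bi-directed edge of
  \<open>K\<close> once, but \<open>arrowheads\<close> counts it twice; this slack yields the
  theorem.\<close>

lemma oriented_by_nbhds_arrowheads:
  assumes K: "ancestral K" "adjacent K = adjacent G" "tails_respect_nbhds K"
    and U': "U = minimal_nbhd_verts G"
  shows "arrowheads H \<le> card (directed_edges K) + card (bidirected_edges K)"
proof -
  let ?ends = "\<lambda>(v, w). {v, w}"
  have simple_K: "simple_mixed_graph K"
    using K by (simp add: ancestral_def)
  have tail: "N a \<subseteq> N b" if "adjacent G a b" "\<not> arrowhead_at K b a" for a b
    using K(2,3) that by (auto simp: tails_respect_nbhds_def closed_nbhd_cong [OF K(2)])
  have "inj_on ?ends (directed_edges H)"
  proof (rule inj_onI, clarify)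
    fix a b c d
    assume "(a, b) \<in> directed_edges H" "(c, d) \<in> directed_edges H" "{a, b} = {c, d}"
    then show "a = c \<and> b = d"
      by (auto simp: doubleton_eq_iff directed_iff)
  qed
  then have "card (directed_edges H) = card (?ends ` directed_edges H)"
    by (simp add: card_image)
  also have "\<dots> \<le> card (?ends ` directed_edges K \<union> bidirected_edges K)"
  proof (rule card_mono)
    show "finite (?ends ` directed_edges K \<union> bidirected_edges K)"
      using simple_finite_edges [OF simple_K] by simp
    have "{v, w} \<in> ?ends ` directed_edges K \<union> bidirected_edges K"
      if vw: "(v, w) \<in> directed_edges H" for v w
    proof -
      have adj: "adjacent G v w"
        using vw by (simp add: directed_iff)
      have "{v, w} \<notin> undirected_edges K"
      proof
        assume undir: "{v, w} \<in> undirected_edges K"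
        then have "N v \<subseteq> N w" "N w \<subseteq> N v"
          using undirected_edge_no_arrowhead [OF simple_K undir] tail adj adjacent_sym [of G v w]
          by auto
        \<comment> \<open>With equal neighbourhoods the edge is directed in \<open>H\<close> only if
          \<open>v\<close> is not minimal. A strictly smaller neighbour then forces an arrowhead at
          \<open>v\<close> in \<open>K\<close>, which an undirected edge at \<open>v\<close>
          forbids.\<close>
        then have "v \<notin> U"
          using vw by (auto simp: directed_iff)
        then obtain u where u: "adjacent G u v" "N u \<subset> N v"
          using U' by (auto simp: minimal_nbhd_verts_def)
        then have "arrowhead_at K u v"
          using tail [of v u] adjacent_sym [of G u v] by auto
        then show False
          using K(1) undir by (auto simp: ancestral_def)
      qed
      moreover have "adjacent K v w"
        using adj K(2) by simp
      ultimately show ?thesis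
        by (force simp: adjacent_def insert_commute)
    qed
    then show "?ends ` directed_edges H \<subseteq> ?ends ` directed_edges K \<union> bidirected_edges K"
      by auto
  qed
  also have "\<dots> \<le> card (?ends ` directed_edges K) + card (bidirected_edges K)"
    by (rule card_Un_le)
  also have "\<dots> \<le> card (directed_edges K) + card (bidirected_edges K)"
    using simple_finite_edges [OF simple_K] by (simp add: card_image_le)
  finally show ?thesis
    by (simp add: arrowheads_def bidirected_empty)
qed

end

section \<open>Comparability and equivalence to a DAG\<close>

text \<open>Each edge of the DAG makes one end an ancestor of the other, and neighbourhoods grow
  from ancestor to descendant.\<close>

lemma dag_equivalent_nbhds_comparable:
  assumes G: "bidirected_graph G" and D: "dag D" "markov_equivalent G D"
  shows "nbhds_comparable G"
  unfolding nbhds_comparable_def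
proof (intro allI impI)
  fix v w assume "adjacent G v w"
  have adj: "adjacent D = adjacent G"
    using markov_equivalent_bidirected_adjacent [OF G D(2)] dag_nonadjacent_separated [OF D(1)]
    by blast
  have simple: "simple_mixed_graph D"
    using D by (simp add: dag_def directed_graph_def)
  have tails: "tails_respect_nbhds D"
    using markov_equivalent_bidirected_tails [OF G D(2) adj] .
  have "adjacent D v w"
    using \<open>adjacent G v w\<close> adj by simp
  then have "ancestor D v w \<or> ancestor D w v"
    using D(1) by (auto simp: adjacent_def ancestor_def dag_def directed_graph_def)
  then show "closed_nbhd G v \<subseteq> closed_nbhd G w \<or> closed_nbhd G w \<subseteq> closed_nbhd G v"
    using ancestor_closed_nbhd [OF simple tails] closed_nbhd_cong [OF adj] by auto
qed

theorem theorem19: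
  fixes G Gmin :: "'v mixed_graph"
  assumes "bidirected_graph G"
    and "minimally_oriented G Gmin"
  shows "(\<exists>D :: 'v mixed_graph. dag D \<and> markov_equivalent G D) \<longleftrightarrow> bidirected_edges Gmin = {}"
proof
  note G = assms(1)
  have maximal: "maximal_ancestral Gmin" and eqv: "markov_equivalent G Gmin"
    using assms(2) by (auto simp: minimally_oriented_def)
  have adj: "adjacent Gmin = adjacent G"
    using markov_equivalent_bidirected_adjacent [OF G eqv] maximal
    unfolding maximal_ancestral_def by meson
  have tails: "tails_respect_nbhds Gmin"
    using markov_equivalent_bidirected_tails [OF G eqv adj] .
  have ancestral: "ancestral Gmin" and simple: "simple_mixed_graph Gmin"
    using maximal by (auto simp: maximal_ancestral_def ancestral_def)
  have "finite (verts G)"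
    using G by (simp add: bidirected_graph_def simple_mixed_graph_def)
  then obtain f :: "'v \<Rightarrow> nat" where f: "inj_on f (verts G)"
    using finite_imp_inj_to_nat_seg by metis
  show "bidirected_edges Gmin = {}" if "\<exists>D. dag D \<and> markov_equivalent G D"
  proof -
    let ?H = "oriented_by_nbhds G f (minimal_nbhd_verts G)"
    have comparable: "nbhds_comparable G"
      using that dag_equivalent_nbhds_comparable [OF G] by blast
    have "arrowheads Gmin \<le> arrowheads ?H"
      using assms(2) oriented_by_nbhds_maximal [OF G comparable f]
        oriented_by_nbhds_markov_equivalent [OF G comparable f]
      by (simp add: minimally_oriented_def)
    also have "\<dots> \<le> card (directed_edges Gmin) + card (bidirected_edges Gmin)"
      using oriented_by_nbhds_arrowheads [OF G comparable f _ ancestral adj tails] by simp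
    \<comment> \<open>With \<open>d\<close> directed and \<open>b\<close> bi-directed edges in
      \<open>Gmin\<close>, the chain reads \<open>d + 2 * b \<le> d + b\<close>.\<close>
    finally have "card (bidirected_edges Gmin) = 0"
      by (simp add: arrowheads_def)
    then show ?thesis
      using simple_finite_edges [OF simple] by simp
  qed
  show "\<exists>D. dag D \<and> markov_equivalent G D" if "bidirected_edges Gmin = {}"
  proof -
    have comparable: "nbhds_comparable G"
      unfolding nbhds_comparable_def
    proof (intro allI impI)
      fix v w assume vw: "adjacent G v w"
      \<comment> \<open>Without bi-directed edges every edge has a tail at some end, and that end
        has the smaller neighbourhood.\<close>
      have "\<not> arrowhead_at Gmin v w \<or> \<not> arrowhead_at Gmin w v"
        using that simple directed_edge_no_opposite_arrowhead [OF simple]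
        by (auto simp: arrowhead_at_def)
      then show "closed_nbhd G v \<subseteq> closed_nbhd G w \<or> closed_nbhd G w \<subseteq> closed_nbhd G v"
        using tails vw adjacent_sym [of G v w]
        by (auto simp: tails_respect_nbhds_def adj closed_nbhd_cong [OF adj])
    qed
    \<comment> \<open>Here \<open>U = {}\<close>, so every tie is oriented by \<open>f\<close> and
      no edge stays undirected.\<close>
    then show ?thesis
      using oriented_by_nbhds_dag [OF G comparable f]
        oriented_by_nbhds_markov_equivalent [OF G comparable f] by blast
  qed
qed

end
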